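(* Let $(X_{it})$ be a real-valued field whose rows $(X_{it})_{t\in\mathbb{Z}}$, $i=1,2,\ldots$, are iid strictly stationary $m$-dependent sequences (for some $m\ge 1$), let $p=p_n\to\infty$ be a sequence of positive integers, and set $S_{ij}^{(n)}=\sum_{t=1}^nX_{it}X_{jt}$, $i,j=1,\ldots,p$. Let $X$ be a generic element of the field, with distribution $F$, and let $(X_i)$ be an iid sequence with common distribution $F$. Assume the following conditions. (i) $X\in\mathbf{RV}(\alpha)$ for some $\alpha>4$; in particular there is a positive sequence $(c_n)$ such that $n\,\mathbb{P}(X^2>c_n)\to1$ and $c_n^{-1}\max_{i=1,\ldots,n}X_i^2\to Y$ in distribution, where $Y$ has the Fréchet distribution $\Phi_{\alpha/2}$. (ii) As $n\to\infty$, for every $x>0$, $$\mathbb{P}\big(S_{11}^{(n)}-n\,\mathbb{E}[X^2]>c_{np}x\big)\sim n\,\mathbb{P}(X^2>c_{np}x).$$ (iii) For every $x>0$ there is a constant $c>0$ such that $$\mathbb{P}\big(|S_{12}^{(n)}-n(\mathbb{E}[X])^2|>c_{np}x\big)\le c\,n\,\mathbb{P}(|X_1X_2|>c_{np}x)=o(p^{-2}),\qquad n\to\infty.$$ Then, as $n\to\infty$, $$c_{np}^{-1}\max_{1\le i<j\le p}\big|S_{ij}^{(n)}-n(\mathbb{E}[X])^2\big|\to0\quad\text{in probability},$$ $$c_{np}^{-1}\max_{i=1,\ldots,p}\big(S_{ii}^{(n)}-n\,\mathbb{E}[X^2]\big)\to Y\quad\text{in distribution}.$$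
   Context: $S_{ij}^{(n)}$ are the entries of the sample covariance matrix $\mathbf X\mathbf X^\top$ of $\mathbf X=(X_{it})_{i=1,\ldots,p;\,t=1,\ldots,n}$; $c_{np}$ denotes the element of the sequence $(c_k)$ with index $k=n\,p_n$. $a_n\sim b_n$ means $a_n/b_n\to1$. $X\in\mathbf{RV}(\alpha)$ means that $\mathbb{P}(X>x)=L(x)x^{-\alpha}$ for a slowly varying function $L$, together with the tail balance condition $\mathbb{P}(X>x)/\mathbb{P}(|X|>x)\to p_+$, $\mathbb{P}(-X>x)/\mathbb{P}(|X|>x)\to p_-$ as $x\to\infty$ for some constants $p_+>0$, $p_-\ge0$. The Fréchet distribution is $\Phi_\beta(x)=e^{-x^{-\beta}}$ for $x>0$ (and $0$ for $x\le0$). A sequence is $m$-dependent if its parts up to time $k$ and after time $k+m$ are independent for every $k$. *)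

theory Defs
  imports "HOL-Probability.Probability" "HOL-Library.Landau_Symbols"
begin

definition slowly_varying :: "(real \<Rightarrow> real) \<Rightarrow> bool" where
  "slowly_varying L \<longleftrightarrow>
     L \<in> borel_measurable (restrict_space borel {0<..}) \<and>
     (\<forall>x>0. L x > 0) \<and>
     (\<forall>s>0. ((\<lambda>x. L (s * x) / L x) \<longlongrightarrow> 1) at_top)"

definition regularly_varying_rv :: "'a measure \<Rightarrow> ('a \<Rightarrow> real) \<Rightarrow> real \<Rightarrow> bool" where
  "regularly_varying_rv M \<xi> \<alpha> \<longleftrightarrow>
     \<xi> \<in> borel_measurable M \<and>
     (\<exists>L. slowly_varying L \<and>
        (\<forall>x>0. measure M {\<omega> \<in> space M. \<xi> \<omega> > x} = L x * x powr (- \<alpha>))) \<and>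
     (\<exists>p_plus>0. \<exists>p_minus\<ge>0.
        ((\<lambda>x. measure M {\<omega> \<in> space M. \<xi> \<omega> > x} / measure M {\<omega> \<in> space M. \<bar>\<xi> \<omega>\<bar> > x})
           \<longlongrightarrow> p_plus) at_top \<and>
        ((\<lambda>x. measure M {\<omega> \<in> space M. - \<xi> \<omega> > x} / measure M {\<omega> \<in> space M. \<bar>\<xi> \<omega>\<bar> > x})
           \<longlongrightarrow> p_minus) at_top)"

definition frechet_cdf :: "real \<Rightarrow> real \<Rightarrow> real" where
  "frechet_cdf \<beta> x = (if x > 0 then exp (- (x powr (- \<beta>))) else 0)"

text \<open>Two-sided sequences are random elements of the product space of real sequences
  indexed by the integers.\<close>

abbreviation seq_space :: "(int \<Rightarrow> real) measure" where
  "seq_space \<equiv> PiM UNIV (\<lambda>_. borel)"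

definition iid_seq :: "'a measure \<Rightarrow> 'b measure \<Rightarrow> (nat \<Rightarrow> 'a \<Rightarrow> 'b) \<Rightarrow> bool" where
  \<comment> \<open>the sequence starts at index 1; measurability is part of \<open>indep_vars\<close>\<close>
  "iid_seq M S Z \<longleftrightarrow>
     prob_space.indep_vars M (\<lambda>_. S) Z {1..} \<and>
     (\<forall>i\<ge>1. distr M S (Z i) = distr M S (Z 1))"

definition strictly_stationary :: "'a measure \<Rightarrow> (int \<Rightarrow> 'a \<Rightarrow> real) \<Rightarrow> bool" where
  "strictly_stationary M Y \<longleftrightarrow>
     (\<forall>t. Y t \<in> borel_measurable M) \<and>
     (\<forall>h. distr M seq_space (\<lambda>\<omega> t. Y (t + h) \<omega>) = distr M seq_space (\<lambda>\<omega> t. Y t \<omega>))"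

definition m_dependent :: "'a measure \<Rightarrow> nat \<Rightarrow> (int \<Rightarrow> 'a \<Rightarrow> real) \<Rightarrow> bool" where
  "m_dependent M m Y \<longleftrightarrow>
     (\<forall>k. prob_space.indep_var M
        (PiM {..k} (\<lambda>_. borel)) (\<lambda>\<omega>. \<lambda>t\<in>{..k}. Y t \<omega>)
        (PiM {k + int m<..} (\<lambda>_. borel)) (\<lambda>\<omega>. \<lambda>t\<in>{k + int m<..}. Y t \<omega>))"

definition sample_cov :: "(nat \<Rightarrow> int \<Rightarrow> 'a \<Rightarrow> real) \<Rightarrow> nat \<Rightarrow> nat \<Rightarrow> nat \<Rightarrow> 'a \<Rightarrow> real" where
  "sample_cov X n i j \<omega> = (\<Sum>t = 1..int n. X i t \<omega> * X j t \<omega>)"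

definition tendsto_in_prob :: "'a measure \<Rightarrow> (nat \<Rightarrow> 'a \<Rightarrow> real) \<Rightarrow> real \<Rightarrow> bool" where
  "tendsto_in_prob M Z z \<longleftrightarrow>
     (\<forall>\<epsilon>>0. (\<lambda>n. measure M {\<omega> \<in> space M. \<bar>Z n \<omega> - z\<bar> > \<epsilon>}) \<longlonglongrightarrow> 0)"

definition tendsto_in_distribution ::
  "'a measure \<Rightarrow> (nat \<Rightarrow> 'a \<Rightarrow> real) \<Rightarrow> 'b measure \<Rightarrow> ('b \<Rightarrow> real) \<Rightarrow> bool" where
  "tendsto_in_distribution M Z K Y \<longleftrightarrow>
     weak_conv_m (\<lambda>n. distr M borel (Z n)) (distr K borel Y)"

end

theory Submission
  imports Defs
begin

text \<open>
  Why the theorem holds. Distinct rows are iid, so the diagonal entries of the sample covariance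
  matrix are iid, and every off-diagonal entry has the law of the entry at position (1,2).

  Off the diagonal a union bound suffices: there are at most \<open>p\<^sup>2\<close> pairs, and by the large deviation
  assumption each one exceeds the level \<open>c\<^bsub>np\<^esub> \<epsilon>\<close> with probability \<open>o(p\<^sup>-\<^sup>2)\<close>.

  On the diagonal, write \<open>q\<close> for the probability that one centred entry exceeds \<open>c\<^bsub>np\<^esub> x\<close>. By
  independence the maximum stays below the level with probability \<open>(1 - q)\<^sup>p\<close>, and this tends to
  \<open>exp(-a)\<close> as soon as \<open>p q \<longrightarrow> a\<close> (\<open>power_tendsto_exp_minus\<close>). The large deviation assumption
  gives \<open>p q \<sim> n p P(X\<^sup>2 > c\<^bsub>np\<^esub> x)\<close>, so the largest of the \<open>p\<close> sums behaves
  like the largest of \<open>n p\<close> independent squares, and regular variation evaluates the limit as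
  \<open>x\<^bsup>-\<alpha>/2\<^esup>\<close> (\<open>normalized_square_tail\<close>). This treats the positive arguments; the Frechet distribution
  function vanishes continuously at 0, so monotonicity of distribution functions settles the others
  (\<open>frechet_limit_from_positive\<close>).
\<close>

section \<open>Powers with a Poisson limit\<close>

text \<open>This is the limiting probability that none of many rare independent events occurs; it follows
  from the two bounds
  \<open>exp (- q / (1 - q)) \<le> 1 - q \<le> exp (- q)\<close> for \<open>q < 1\<close>.\<close>

lemma power_tendsto_exp_minus:
  fixes q :: "nat \<Rightarrow> real" and p :: "nat \<Rightarrow> nat"
  assumes pq: "(\<lambda>n. real (p n) * q n) \<longlonglongrightarrow> a"
    and p: "filterlim p at_top sequentially"
  shows "(\<lambda>n. (1 - q n) ^ p n) \<longlonglongrightarrow> exp (- a)"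
proof -
  have rp: "filterlim (\<lambda>n. real (p n)) at_top sequentially"
    by (rule filterlim_compose[OF filterlim_real_sequentially p])
  have "(\<lambda>n. (real (p n) * q n) / real (p n)) \<longlonglongrightarrow> 0"
    by (rule tendsto_divide_0[OF pq filterlim_at_top_imp_at_infinity[OF rp]])
  moreover have "\<forall>\<^sub>F n in sequentially. (real (p n) * q n) / real (p n) = q n"
    using filterlim_at_top_dense[THEN iffD1, OF rp, rule_format, of 0]
    by eventually_elim simp
  ultimately have q0: "q \<longlonglongrightarrow> 0"
    by (rule Lim_transform_eventually)
  have small: "\<forall>\<^sub>F n in sequentially. q n < 1"
    using order_tendstoD(2)[OF q0, of 1] by simp
  show ?thesis
  proof (rule tendsto_sandwich)
    show "(\<lambda>n. exp (- (real (p n) * q n / (1 - q n)))) \<longlonglongrightarrow> exp (- a)"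
    proof -
      have "(\<lambda>n. exp (- (real (p n) * q n / (1 - q n)))) \<longlonglongrightarrow> exp (- (a / (1 - 0)))"
        by (intro tendsto_intros pq q0) simp
      then show ?thesis by simp
    qed
    show "(\<lambda>n. exp (- (real (p n) * q n))) \<longlonglongrightarrow> exp (- a)"
      by (intro tendsto_intros pq)
    show "\<forall>\<^sub>F n in sequentially. exp (- (real (p n) * q n / (1 - q n))) \<le> (1 - q n) ^ p n"
      using small
    proof eventually_elim
      case (elim n)
      have "inverse (1 - q n) = 1 + q n / (1 - q n)"
        using elim by (simp add: field_simps)
      also have "\<dots> \<le> exp (q n / (1 - q n))"
        by (rule exp_ge_add_one_self)
      finally have "inverse (exp (q n / (1 - q n))) \<le> 1 - q n"
        using elim by (metis diff_gt_0_iff_gt inverse_inverse_eq le_imp_inverse_le positive_imp_inverse_positive)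
      then have "exp (- (q n / (1 - q n))) ^ p n \<le> (1 - q n) ^ p n"
        by (intro power_mono) (simp_all add: exp_minus)
      then show ?case
        by (simp add: exp_of_nat_mult[symmetric])
    qed
    show "\<forall>\<^sub>F n in sequentially. (1 - q n) ^ p n \<le> exp (- (real (p n) * q n))"
      using small
    proof eventually_elim
      case (elim n)
      have "(1 - q n) ^ p n \<le> exp (- q n) ^ p n"
        using exp_ge_add_one_self[of "- q n"] elim by (intro power_mono) simp_all
      then show ?case
        by (simp add: exp_of_nat_mult[symmetric])
    qed
  qed
qed

section \<open>Regularly varying tails\<close>

text \<open>Since \<open>p\<^sub>+ > 0\<close>, tail balance makes the tail of \<open>\<bar>\<xi>\<bar>\<close> asymptotically proportional to the right
  tail, from which it inherits both positivity and the index of regular variation.\<close>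

lemma regularly_varying_abs_tail:
  assumes "prob_space M" and RV: "regularly_varying_rv M \<xi> \<alpha>"
  defines "T \<equiv> \<lambda>u. measure M {\<omega> \<in> space M. \<bar>\<xi> \<omega>\<bar> > u}"
  shows "\<And>u. T u > 0"
    and "\<And>s. s > 0 \<Longrightarrow> ((\<lambda>u. T (s * u) / T u) \<longlongrightarrow> s powr (- \<alpha>)) at_top"
proof -
  interpret prob_space M by fact
  define R where "R u = measure M {\<omega> \<in> space M. \<xi> \<omega> > u}" for u
  from RV obtain L pp where meas[measurable]: "\<xi> \<in> borel_measurable M"
    and L: "slowly_varying L" and RL: "\<And>x. x > 0 \<Longrightarrow> R x = L x * x powr (- \<alpha>)"
    and pp: "pp > 0" and ratio: "((\<lambda>x. R x / T x) \<longlongrightarrow> pp) at_top"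
    unfolding regularly_varying_rv_def R_def T_def by blast
  have Lpos: "L x > 0" if "x > 0" for x
    using L that by (simp add: slowly_varying_def)
  have Rpos: "R x > 0" if "x > 0" for x
    using RL Lpos that by simp
  show Tpos: "T u > 0" for u
  proof -
    have "0 < R (max u 1)"
      by (rule Rpos) simp
    also have "\<dots> \<le> T u"
      unfolding R_def T_def by (intro finite_measure_mono) auto
    finally show ?thesis .
  qed
  fix s :: real assume s: "s > 0"
  have scale: "filterlim (\<lambda>u. s * u) at_top at_top"
    by (rule filterlim_tendsto_pos_mult_at_top[OF tendsto_const s filterlim_ident])
  have "((\<lambda>u. (L (s * u) / L u) * s powr (- \<alpha>) * (R u / T u) / (R (s * u) / T (s * u)))
      \<longlongrightarrow> 1 * s powr (- \<alpha>) * pp / pp) at_top"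
    using L s pp ratio
    by (intro tendsto_intros filterlim_compose[OF ratio scale]) (auto simp: slowly_varying_def)
  moreover have "\<forall>\<^sub>F u in at_top. (L (s * u) / L u) * s powr (- \<alpha>) * (R u / T u) / (R (s * u) / T (s * u))
      = T (s * u) / T u"
    using eventually_gt_at_top[of 0]
  proof eventually_elim
    case (elim u)
    have "L u > 0" "L (s * u) > 0" "T u > 0" "T (s * u) > 0" "R u > 0" "R (s * u) > 0" "s * u > 0"
      using elim s Lpos Rpos Tpos by auto
    moreover have "R (s * u) = L (s * u) * (s powr (- \<alpha>) * u powr (- \<alpha>))"
      using RL[of "s * u"] elim s by (simp add: powr_mult)
    moreover have "R u = L u * u powr (- \<alpha>)"
      using RL elim by simp
    ultimately show ?case
      using elim s by (simp add: field_simps)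
  qed
  ultimately show "((\<lambda>u. T (s * u) / T u) \<longlongrightarrow> s powr (- \<alpha>)) at_top"
    using pp by (auto dest: Lim_transform_eventually)
qed

text \<open>The normalization \<open>n P(\<xi>\<^sup>2 > c\<^sub>n) \<longrightarrow> 1\<close> forces \<open>c\<^sub>n \<longrightarrow> \<infinity>\<close>, because no tail probability of \<open>\<xi>\<^sup>2\<close> is
  zero. Regular variation of \<open>\<bar>\<xi>\<bar>\<close> along \<open>\<surd>c\<^sub>n\<close> with factor \<open>\<surd>x\<close> then gives the limit at every other
  level; the square halves the index.\<close>

lemma normalized_square_tail:
  assumes M: "prob_space M" and RV: "regularly_varying_rv M \<xi> \<alpha>"
    and c_lim: "(\<lambda>n. real n * measure M {\<omega> \<in> space M. (\<xi> \<omega>)\<^sup>2 > c n}) \<longlonglongrightarrow> 1"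
    and x: "x > 0"
  shows "(\<lambda>n. real n * measure M {\<omega> \<in> space M. (\<xi> \<omega>)\<^sup>2 > c n * x}) \<longlonglongrightarrow> x powr (- (\<alpha> / 2))"
proof -
  interpret prob_space M by fact
  have [measurable]: "\<xi> \<in> borel_measurable M"
    using RV by (simp add: regularly_varying_rv_def)
  define T where "T u = measure M {\<omega> \<in> space M. \<bar>\<xi> \<omega>\<bar> > u}" for u
  note Tpos = regularly_varying_abs_tail(1)[OF M RV, folded T_def]
  note Tlim = regularly_varying_abs_tail(2)[OF M RV, folded T_def]
  define G where "G u = measure M {\<omega> \<in> space M. (\<xi> \<omega>)\<^sup>2 > u}" for u
  have GT: "G u = T (sqrt u)" if "u \<ge> 0" for u
  proof -
    have "(\<xi> \<omega>)\<^sup>2 > u \<longleftrightarrow> \<bar>\<xi> \<omega>\<bar> > sqrt u" for \<omega>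
      by (metis real_sqrt_abs real_sqrt_less_iff)
    then show ?thesis by (simp add: G_def T_def)
  qed
  have Gmono: "G v \<le> G u" if "u \<le> v" for u v
    unfolding G_def using that by (intro finite_measure_mono) auto
  have "(\<lambda>n. (real n * G (c n)) / real n) \<longlonglongrightarrow> 0"
    by (rule tendsto_divide_0[OF c_lim[folded G_def]
          filterlim_at_top_imp_at_infinity[OF filterlim_real_sequentially]])
  moreover have "\<forall>\<^sub>F n in sequentially. (real n * G (c n)) / real n = G (c n)"
    using eventually_gt_at_top[of 0] by eventually_elim simp
  ultimately have G0: "(\<lambda>n. G (c n)) \<longlonglongrightarrow> 0"
    by (rule Lim_transform_eventually)
  have c_inf: "filterlim c at_top sequentially"
    unfolding filterlim_at_top_dense
  proof
    fix z :: real
    have "G (max z 0) > 0"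
      using GT Tpos by simp
    then have "\<forall>\<^sub>F n in sequentially. G (c n) < G (max z 0)"
      by (rule order_tendstoD(2)[OF G0])
    then show "\<forall>\<^sub>F n in sequentially. z < c n"
    proof eventually_elim
      case (elim n)
      then have "\<not> c n \<le> max z 0"
        using Gmono by (meson linorder_not_le)
      then show ?case by simp
    qed
  qed
  have "(\<lambda>n. T (sqrt x * sqrt (c n)) / T (sqrt (c n))) \<longlonglongrightarrow> sqrt x powr (- \<alpha>)"
    using x by (intro filterlim_compose[OF Tlim filterlim_compose[OF sqrt_at_top c_inf]]) simp
  then have "(\<lambda>n. T (sqrt x * sqrt (c n)) / T (sqrt (c n)) * (real n * G (c n)))
      \<longlonglongrightarrow> sqrt x powr (- \<alpha>) * 1"
    by (rule tendsto_mult) (rule c_lim[folded G_def])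
  moreover have "sqrt x powr (- \<alpha>) = x powr (- (\<alpha> / 2))"
    using x by (simp add: powr_half_sqrt[symmetric] powr_powr)
  moreover have "\<forall>\<^sub>F n in sequentially.
      T (sqrt x * sqrt (c n)) / T (sqrt (c n)) * (real n * G (c n)) = real n * G (c n * x)"
    using filterlim_at_top_dense[THEN iffD1, OF c_inf, rule_format, of 0]
  proof eventually_elim
    case (elim n)
    then have "G (c n * x) = T (sqrt x * sqrt (c n))" "G (c n) = T (sqrt (c n))"
      using x by (simp_all add: GT real_sqrt_mult mult.commute)
    then show ?case
      using Tpos[of "sqrt (c n)"] by simp
  qed
  ultimately show ?thesis
    unfolding G_def by (auto dest: Lim_transform_eventually)
qed

section \<open>Convergence to a Frechet distribution function\<close>

text \<open>At a nonpositive argument the values are squeezed between 0 and those at small positive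
  arguments, whose limits are arbitrarily close to 0.\<close>

lemma frechet_limit_from_positive:
  fixes f :: "nat \<Rightarrow> real \<Rightarrow> real"
  assumes mono: "\<And>n x y. x \<le> y \<Longrightarrow> f n x \<le> f n y" and nonneg: "\<And>n x. f n x \<ge> 0"
    and pos: "\<And>x. x > 0 \<Longrightarrow> (\<lambda>n. f n x) \<longlonglongrightarrow> frechet_cdf \<beta> x"
    and \<beta>: "\<beta> > 0"
  shows "(\<lambda>n. f n x) \<longlonglongrightarrow> frechet_cdf \<beta> x"
proof (cases "x > 0")
  case True
  then show ?thesis by (rule pos)
next
  case False
  have "(\<lambda>n. f n x) \<longlonglongrightarrow> 0"
  proof (rule order_tendstoI)
    fix e :: real assume "e < 0"
    then show "\<forall>\<^sub>F n in sequentially. e < f n x"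
      by (intro always_eventually allI less_le_trans[OF _ nonneg])
  next
    fix e :: real assume e: "e > 0"
    \<comment> \<open>the level at which the Frechet distribution function equals \<open>exp (- b) < e\<close>\<close>
    define b where "b = max 1 (1 - ln e)"
    define y where "y = b powr (- (1 / \<beta>))"
    have b: "b > 0" "- b < ln e" by (auto simp: b_def)
    have y: "y > 0" using b by (simp add: y_def)
    have "frechet_cdf \<beta> y = exp (- b)"
      using y b \<beta> by (simp add: frechet_cdf_def) (simp add: y_def powr_powr)
    also have "\<dots> < e"
      using b e by (metis exp_less_mono exp_ln)
    finally have "\<forall>\<^sub>F n in sequentially. f n y < e"
      by (rule order_tendstoD(2)[OF pos[OF y]])
    then show "\<forall>\<^sub>F n in sequentially. f n x < e"
    proof eventually_elim
      case (elim n)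
      have "f n x \<le> f n y"
        using False y by (intro mono) simp
      with elim show ?case by simp
    qed
  qed
  then show ?thesis
    using False by (simp add: frechet_cdf_def)
qed

section \<open>Independent and identically distributed sequences\<close>

lemma (in prob_space) prob_eq_of_distr_eq:
  assumes [measurable]: "V \<in> measurable M S" "W \<in> measurable M S" "Measurable.pred S P"
    and eq: "distr M S V = distr M S W"
  shows "prob {\<omega> \<in> space M. P (V \<omega>)} = prob {\<omega> \<in> space M. P (W \<omega>)}"
proof -
  have *: "prob {\<omega> \<in> space M. P (U \<omega>)} = measure (distr M S U) {s \<in> space S. P s}"
    if [measurable]: "U \<in> measurable M S" for U
  proof -
    have "U -` {s \<in> space S. P s} \<inter> space M = {\<omega> \<in> space M. P (U \<omega>)}"
      using measurable_space[OF that] by auto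
    then show ?thesis
      by (subst measure_distr) auto
  qed
  show ?thesis
    by (simp add: * eq)
qed

text \<open>Both marginals of a pair of distinct members are the common law, and independence makes the joint
  law their product; hence all such pairs are equidistributed.\<close>

lemma (in prob_space) iid_seq_pair_distr:
  assumes iid: "iid_seq M S Z" and ij: "i \<ge> 1" "j \<ge> 1" "i \<noteq> j"
  shows "distr M (S \<Otimes>\<^sub>M S) (\<lambda>\<omega>. (Z i \<omega>, Z j \<omega>)) = distr M S (Z 1) \<Otimes>\<^sub>M distr M S (Z 1)"
proof -
  have indep: "indep_vars (\<lambda>_. S) Z {1..}" and law: "\<And>k. k \<ge> 1 \<Longrightarrow> distr M S (Z k) = distr M S (Z 1)"
    using iid unfolding iid_seq_def by blast+
  have "indep_var (PiM {i} (\<lambda>_. S)) (\<lambda>\<omega>. \<lambda>k\<in>{i}. Z k \<omega>) (PiM {j} (\<lambda>_. S)) (\<lambda>\<omega>. \<lambda>k\<in>{j}. Z k \<omega>)"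
    using ij by (intro indep_var_restrict[OF indep]) auto
  then have "indep_var S ((\<lambda>f. f i) \<circ> (\<lambda>\<omega>. \<lambda>k\<in>{i}. Z k \<omega>)) S ((\<lambda>f. f j) \<circ> (\<lambda>\<omega>. \<lambda>k\<in>{j}. Z k \<omega>))"
    by (rule indep_var_compose) (auto intro: measurable_component_singleton)
  then have "indep_var S (Z i) S (Z j)"
    by (simp add: comp_def)
  then show ?thesis
    using law[OF ij(1)] law[OF ij(2)] by (metis indep_var_distribution_eq)
qed

lemma (in prob_space) prob_Max_iid_le:
  fixes V :: "nat \<Rightarrow> 'a \<Rightarrow> real"
  assumes iid: "iid_seq M borel V" and r: "r \<ge> 1"
  shows "prob {\<omega> \<in> space M. (MAX i\<in>{1..r}. V i \<omega>) \<le> a} = prob {\<omega> \<in> space M. V 1 \<omega> \<le> a} ^ r"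
proof -
  have indep: "indep_vars (\<lambda>_. borel) V {1..}" and law: "\<And>k. k \<ge> 1 \<Longrightarrow> distr M borel (V k) = distr M borel (V 1)"
    using iid unfolding iid_seq_def by blast+
  have meas: "V k \<in> borel_measurable M" if "k \<ge> 1" for k
    using indep that by (auto simp: indep_vars_def)
  have "{\<omega> \<in> space M. (MAX i\<in>{1..r}. V i \<omega>) \<le> a} = (\<Inter>i\<in>{1..r}. V i -` {..a} \<inter> space M)"
    using r by (auto simp: Max_le_iff)
  also have "prob \<dots> = (\<Prod>i\<in>{1..r}. prob (V i -` {..a} \<inter> space M))"
    using r by (intro indep_varsD[OF indep]) auto
  also have "\<dots> = (\<Prod>i\<in>{1..r}. prob {\<omega> \<in> space M. V 1 \<omega> \<le> a})"
  proof (rule prod.cong)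
    fix i assume "i \<in> {1..r}"
    then have "prob {\<omega> \<in> space M. V i \<omega> \<le> a} = prob {\<omega> \<in> space M. V 1 \<omega> \<le> a}"
      by (intro prob_eq_of_distr_eq[where S = borel and P = "\<lambda>v. v \<le> a"] meas law) auto
    then show "prob (V i -` {..a} \<inter> space M) = prob {\<omega> \<in> space M. V 1 \<omega> \<le> a}"
      by (simp add: vimage_def Int_def conj_commute)
  qed simp
  finally show ?thesis by simp
qed

lemma (in prob_space) iid_seq_compose:
  assumes iid: "iid_seq M S Z" and [measurable]: "g \<in> measurable S T"
  shows "iid_seq M T (\<lambda>i \<omega>. g (Z i \<omega>))"
proof -
  have indep: "indep_vars (\<lambda>_. S) Z {1..}" and law: "\<And>k. k \<ge> 1 \<Longrightarrow> distr M S (Z k) = distr M S (Z 1)"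
    using iid unfolding iid_seq_def by blast+
  have meas: "Z k \<in> measurable M S" if "k \<ge> 1" for k
    using indep that by (auto simp: indep_vars_def)
  have push: "distr M T (\<lambda>\<omega>. g (Z i \<omega>)) = distr (distr M S (Z i)) T g" if "i \<ge> 1" for i
    using meas[OF that] by (simp add: distr_distr comp_def)
  show ?thesis
    unfolding iid_seq_def
  proof (intro conjI allI impI)
    show "indep_vars (\<lambda>_. T) (\<lambda>i \<omega>. g (Z i \<omega>)) {1..}"
      by (rule indep_vars_compose2[OF indep]) simp
    show "distr M T (\<lambda>\<omega>. g (Z i \<omega>)) = distr M T (\<lambda>\<omega>. g (Z 1 \<omega>))" if "i \<ge> 1" for i
      unfolding push[OF that] push[OF order_refl] law[OF that] ..
  qed
qed

section \<open>Maxima of the sample covariances\<close>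

theorem lemma5p1:
  fixes M :: "'a measure" and N :: "'b measure" and K :: "'c measure"
    and X :: "nat \<Rightarrow> int \<Rightarrow> 'a \<Rightarrow> real"
    and \<xi> :: "'a \<Rightarrow> real"
    and Z :: "nat \<Rightarrow> 'b \<Rightarrow> real"
    and Y :: "'c \<Rightarrow> real"
    and F :: "real measure"
    and p :: "nat \<Rightarrow> nat" and c :: "nat \<Rightarrow> real"
    and m :: nat and \<alpha> :: real
  assumes prob_spaces: "prob_space M" "prob_space N" "prob_space K"
    and rows_iid: "iid_seq M seq_space (\<lambda>i \<omega> t. X i t \<omega>)"
    and rows_stationary: "\<And>i. i \<ge> 1 \<Longrightarrow> strictly_stationary M (X i)"
    and m_pos: "m \<ge> 1"
    and rows_m_dependent: "\<And>i. i \<ge> 1 \<Longrightarrow> m_dependent M m (X i)"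
    and p_pos: "\<And>n. n \<ge> 1 \<Longrightarrow> p n \<ge> 1"
    and p_lim: "filterlim p at_top sequentially"
    and F_def: "F = distr M borel (X 1 1)"
    and generic: "\<xi> \<in> borel_measurable M" "distr M borel \<xi> = F"
    and Z_iid: "iid_seq N borel Z" "distr N borel (Z 1) = F"
    and alpha: "\<alpha> > 4"
    and RV: "regularly_varying_rv M \<xi> \<alpha>"
    and c_pos: "\<And>n. n \<ge> 1 \<Longrightarrow> c n > 0"
    and c_lim: "(\<lambda>n. real n * measure M {\<omega> \<in> space M. (\<xi> \<omega>)\<^sup>2 > c n}) \<longlonglongrightarrow> 1"
    and Y_frechet: "Y \<in> borel_measurable K" "cdf (distr K borel Y) = frechet_cdf (\<alpha> / 2)"
    and cond_diag: "\<And>x. x > 0 \<Longrightarrow>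
      (\<lambda>n. measure M {\<omega> \<in> space M.
              sample_cov X n 1 1 \<omega> - real n * integral\<^sup>L M (\<lambda>\<omega>. (\<xi> \<omega>)\<^sup>2) > c (n * p n) * x}
           / (real n * measure M {\<omega> \<in> space M. (\<xi> \<omega>)\<^sup>2 > c (n * p n) * x})) \<longlonglongrightarrow> 1"
    and cond_offdiag: "\<And>x. x > 0 \<Longrightarrow> \<exists>C>0.
      (\<forall>\<^sub>F n in sequentially.
         measure M {\<omega> \<in> space M.
              \<bar>sample_cov X n 1 2 \<omega> - real n * (integral\<^sup>L M \<xi>)\<^sup>2\<bar> > c (n * p n) * x}
         \<le> C * real n * measure N {\<omega> \<in> space N. \<bar>Z 1 \<omega> * Z 2 \<omega>\<bar> > c (n * p n) * x}) \<and>
      (\<lambda>n. C * real n * measure N {\<omega> \<in> space N. \<bar>Z 1 \<omega> * Z 2 \<omega>\<bar> > c (n * p n) * x})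
        \<in> o[sequentially](\<lambda>n. 1 / (real (p n))\<^sup>2)"
  shows "tendsto_in_prob M
           (\<lambda>n \<omega>. Max {\<bar>sample_cov X n i j \<omega> - real n * (integral\<^sup>L M \<xi>)\<^sup>2\<bar> | i j.
                        1 \<le> i \<and> i < j \<and> j \<le> p n} / c (n * p n)) 0 \<and>
         tendsto_in_distribution M
           (\<lambda>n \<omega>. (MAX i\<in>{1..p n}. sample_cov X n i i \<omega>
                        - real n * integral\<^sup>L M (\<lambda>\<omega>. (\<xi> \<omega>)\<^sup>2)) / c (n * p n)) K Y"
proof -
  interpret prob_space M by (rule prob_spaces)
  let ?R = "\<lambda>i \<omega> t. X i t \<omega>"
  let ?\<mu>2 = "integral\<^sup>L M (\<lambda>\<omega>. (\<xi> \<omega>)\<^sup>2)"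
  let ?\<mu> = "(integral\<^sup>L M \<xi>)\<^sup>2"
  have row_meas: "?R i \<in> measurable M seq_space" if "i \<ge> 1" for i
    using rows_iid that unfolding iid_seq_def indep_vars_def by blast
  have cov_meas: "sample_cov X n i j \<in> borel_measurable M" if "i \<ge> 1" "j \<ge> 1" for n i j
    unfolding sample_cov_def using rows_stationary that
    by (intro borel_measurable_sum borel_measurable_times) (auto simp: strictly_stationary_def)
  have cnp: "c (n * p n) > 0" if "n \<ge> 1" for n
    using c_pos p_pos[OF that] that by simp
  \<comment> \<open>for \<open>p n < 2\<close> there is no off-diagonal pair and the first maximum is that of the empty set\<close>
  have big: "\<forall>\<^sub>F n in sequentially. n \<ge> 1 \<and> p n \<ge> 2"
    using eventually_ge_at_top[of 1] p_lim[unfolded filterlim_at_top, rule_format, of 2]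
    by eventually_elim simp

  have "tendsto_in_prob M
           (\<lambda>n \<omega>. Max {\<bar>sample_cov X n i j \<omega> - real n * ?\<mu>\<bar> | i j.
                        1 \<le> i \<and> i < j \<and> j \<le> p n} / c (n * p n)) 0"
    unfolding tendsto_in_prob_def
  proof (intro allI impI)
    fix e :: real assume e: "e > 0"
    define D where "D n i j \<omega> = \<bar>sample_cov X n i j \<omega> - real n * ?\<mu>\<bar>" for n i j \<omega>
    have D_meas[measurable]: "D n i j \<in> borel_measurable M" if "i \<ge> 1" "j \<ge> 1" for n i j
      unfolding D_def using cov_meas[OF that] by simp
    have same: "prob {\<omega> \<in> space M. D n i j \<omega> > a} = prob {\<omega> \<in> space M. D n 1 2 \<omega> > a}"
      if ij: "i \<ge> 1" "i < j" for n i j a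
    proof -
      define P where "P = (\<lambda>(f, g). \<bar>(\<Sum>t = 1..int n. f t * g t) - real n * ?\<mu>\<bar> > a)"
      have P: "Measurable.pred (seq_space \<Otimes>\<^sub>M seq_space) P"
        unfolding P_def by measurable
      have "distr M (seq_space \<Otimes>\<^sub>M seq_space) (\<lambda>\<omega>. (?R i \<omega>, ?R j \<omega>)) =
            distr M (seq_space \<Otimes>\<^sub>M seq_space) (\<lambda>\<omega>. (?R 1 \<omega>, ?R 2 \<omega>))"
        using iid_seq_pair_distr[OF rows_iid, of i j] iid_seq_pair_distr[OF rows_iid, of 1 2] ij
        by simp
      then have "prob {\<omega> \<in> space M. P (?R i \<omega>, ?R j \<omega>)} = prob {\<omega> \<in> space M. P (?R 1 \<omega>, ?R 2 \<omega>)}"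
        using row_meas ij by (intro prob_eq_of_distr_eq[OF _ _ P] measurable_Pair) auto
      then show ?thesis
        by (simp add: P_def D_def sample_cov_def)
    qed
    define I where "I n = {(i, j). 1 \<le> i \<and> i < j \<and> j \<le> p n}" for n
    have I_sub: "I n \<subseteq> {1..p n} \<times> {1..p n}" for n
      by (auto simp: I_def)
    have I_fin: "finite (I n)" for n
      by (rule finite_subset[OF I_sub]) simp
    have I_card: "card (I n) \<le> (p n)\<^sup>2" for n
      using card_mono[OF _ I_sub[of n]] by (simp add: power2_eq_square)
    from cond_offdiag[OF e] obtain C where
      C1: "\<forall>\<^sub>F n in sequentially. prob {\<omega> \<in> space M. D n 1 2 \<omega> > c (n * p n) * e}
         \<le> C * real n * measure N {\<omega> \<in> space N. \<bar>Z 1 \<omega> * Z 2 \<omega>\<bar> > c (n * p n) * e}"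
      and C2: "(\<lambda>n. C * real n * measure N {\<omega> \<in> space N. \<bar>Z 1 \<omega> * Z 2 \<omega>\<bar> > c (n * p n) * e})
        \<in> o[sequentially](\<lambda>n. 1 / (real (p n))\<^sup>2)"
      unfolding D_def by blast
    define B where "B n = C * real n * measure N {\<omega> \<in> space N. \<bar>Z 1 \<omega> * Z 2 \<omega>\<bar> > c (n * p n) * e}" for n
    have lim: "(\<lambda>n. (real (p n))\<^sup>2 * B n) \<longlonglongrightarrow> 0"
      using smalloD_tendsto[OF C2[folded B_def]] by (simp add: mult.commute)
    show "(\<lambda>n. prob {\<omega> \<in> space M. \<bar>Max {\<bar>sample_cov X n i j \<omega> - real n * ?\<mu>\<bar> | i j.
                        1 \<le> i \<and> i < j \<and> j \<le> p n} / c (n * p n) - 0\<bar> > e}) \<longlonglongrightarrow> 0"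
    proof (rule tendsto_sandwich[OF _ _ tendsto_const lim])
      show "\<forall>\<^sub>F n in sequentially. prob {\<omega> \<in> space M. \<bar>Max {\<bar>sample_cov X n i j \<omega> - real n * ?\<mu>\<bar> | i j.
                        1 \<le> i \<and> i < j \<and> j \<le> p n} / c (n * p n) - 0\<bar> > e} \<le> (real (p n))\<^sup>2 * B n"
        using big C1[folded B_def]
      proof eventually_elim
        case (elim n)
        let ?A = "\<lambda>(i, j). {\<omega> \<in> space M. D n i j \<omega> > c (n * p n) * e}"
        have ne: "I n \<noteq> {}"
        proof -
          have "(1, 2) \<in> I n"
            using elim by (simp add: I_def)
          then show ?thesis by blast
        qed
        have set_eq: "{\<bar>sample_cov X n i j \<omega> - real n * ?\<mu>\<bar> | i j. 1 \<le> i \<and> i < j \<and> j \<le> p n}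
            = (\<lambda>(i, j). D n i j \<omega>) ` I n" for \<omega>
          unfolding I_def D_def by (fastforce simp: image_iff)
        have exceeds: "\<exists>ij\<in>I n. \<omega> \<in> ?A ij"
          if "\<omega> \<in> space M" and gt: "\<bar>Max ((\<lambda>(i, j). D n i j \<omega>) ` I n) / c (n * p n) - 0\<bar> > e" for \<omega>
        proof -
          let ?m = "Max ((\<lambda>(i, j). D n i j \<omega>) ` I n)"
          have m: "?m \<in> (\<lambda>(i, j). D n i j \<omega>) ` I n"
            using I_fin ne by (intro Max_in) auto
          then have "?m \<ge> 0"
            by (auto simp: D_def)
          then have "?m > c (n * p n) * e"
            using gt cnp[of n] elim by (simp add: pos_less_divide_eq mult.commute)
          moreover obtain i j where "(i, j) \<in> I n" "?m = D n i j \<omega>"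
            using m by auto
          ultimately show ?thesis
            using that(1) by (intro bexI[of _ "(i, j)"]) auto
        qed
        have A_sets: "?A ij \<in> sets M" if mem: "ij \<in> I n" for ij
        proof -
          obtain i j where ij: "ij = (i, j)" "i \<ge> 1" "j \<ge> 1"
            using mem by (auto simp: I_def)
          have [measurable]: "D n i j \<in> borel_measurable M"
            by (rule D_meas[OF ij(2,3)])
          show ?thesis
            unfolding ij by simp
        qed
        have "prob {\<omega> \<in> space M. \<bar>Max ((\<lambda>(i, j). D n i j \<omega>) ` I n) / c (n * p n) - 0\<bar> > e}
            \<le> prob (\<Union>ij\<in>I n. ?A ij)"
        proof (rule finite_measure_mono)
          show "{\<omega> \<in> space M. \<bar>Max ((\<lambda>(i, j). D n i j \<omega>) ` I n) / c (n * p n) - 0\<bar> > e}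
              \<subseteq> (\<Union>ij\<in>I n. ?A ij)"
            using exceeds by blast
          show "(\<Union>ij\<in>I n. ?A ij) \<in> sets M"
            using I_fin A_sets by (rule sets.finite_UN)
        qed
        also have "\<dots> \<le> (\<Sum>ij\<in>I n. prob (?A ij))"
          using I_fin A_sets by (intro measure_UNION_le) auto
        also have "\<dots> = (\<Sum>ij\<in>I n. prob {\<omega> \<in> space M. D n 1 2 \<omega> > c (n * p n) * e})"
        proof (rule sum.cong[OF refl])
          fix ij assume "ij \<in> I n"
          then obtain i j where "ij = (i, j)" "i \<ge> 1" "i < j"
            by (auto simp: I_def)
          then show "prob (?A ij) = prob {\<omega> \<in> space M. D n 1 2 \<omega> > c (n * p n) * e}"
            using same[of i j] by simp
        qed
        also have "\<dots> \<le> real (card (I n)) * B n"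
          by (rule sum_bounded_above) (rule elim(2))
        also have "\<dots> \<le> (real (p n))\<^sup>2 * B n"
        proof (rule mult_right_mono)
          show "real (card (I n)) \<le> (real (p n))\<^sup>2"
            using I_card[of n] by (metis of_nat_le_iff of_nat_power)
          show "B n \<ge> 0"
            by (rule order_trans[OF measure_nonneg elim(2)])
        qed
        finally show ?case
          unfolding set_eq .
      qed
    qed simp
  qed

  moreover have "tendsto_in_distribution M
           (\<lambda>n \<omega>. (MAX i\<in>{1..p n}. sample_cov X n i i \<omega> - real n * ?\<mu>2) / c (n * p n)) K Y"
  proof -
    define V where "V n i \<omega> = sample_cov X n i i \<omega> - real n * ?\<mu>2" for n i \<omega>
    define W where "W n \<omega> = (MAX i\<in>{1..p n}. V n i \<omega>) / c (n * p n)" for n \<omega>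
    have V_meas: "V n i \<in> borel_measurable M" if "i \<ge> 1" for n i
      unfolding V_def using cov_meas[OF that that] by simp
    have W_meas[measurable]: "W n \<in> borel_measurable M" for n
      unfolding W_def by (intro borel_measurable_divide borel_measurable_Max V_meas) auto
    have V_iid: "iid_seq M borel (V n)" for n
    proof -
      have "(\<lambda>f. (\<Sum>t = 1..int n. f t * f t) - real n * ?\<mu>2) \<in> borel_measurable seq_space"
        by measurable
      from iid_seq_compose[OF rows_iid this] show ?thesis
        by (simp add: V_def[abs_def] sample_cov_def)
    qed
    define f where "f n x = prob {\<omega> \<in> space M. W n \<omega> \<le> x}" for n x
    have np: "filterlim (\<lambda>n. n * p n) at_top sequentially"
    proof (rule filterlim_at_top_mono[OF filterlim_ident])
      show "\<forall>\<^sub>F n in sequentially. n \<le> n * p n"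
        using big by eventually_elim auto
    qed
    have "(\<lambda>n. f n x) \<longlonglongrightarrow> frechet_cdf (\<alpha> / 2) x" if x: "x > 0" for x
    proof -
      define q where "q n = prob {\<omega> \<in> space M. V n 1 \<omega> > c (n * p n) * x}" for n
      define G where "G n = prob {\<omega> \<in> space M. (\<xi> \<omega>)\<^sup>2 > c (n * p n) * x}" for n
      have "(\<lambda>n. real (n * p n) * G n) \<longlonglongrightarrow> x powr (- (\<alpha> / 2))"
        unfolding G_def
        by (rule filterlim_compose[OF normalized_square_tail[OF prob_spaces(1) RV c_lim x] np])
      moreover have ratio: "(\<lambda>n. q n / (real n * G n)) \<longlonglongrightarrow> 1"
        using cond_diag[OF x] by (simp add: q_def G_def V_def)
      ultimately have "(\<lambda>n. q n / (real n * G n) * (real (n * p n) * G n)) \<longlonglongrightarrow> 1 * x powr (- (\<alpha> / 2))"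
        by (intro tendsto_mult)
      \<comment> \<open>the ratio is eventually nonzero, so its denominator may be cancelled\<close>
      moreover have "\<forall>\<^sub>F n in sequentially.
          q n / (real n * G n) * (real (n * p n) * G n) = real (p n) * q n"
        using order_tendstoD(1)[OF ratio, of 0, OF zero_less_one]
        by eventually_elim (auto simp: field_simps zero_less_divide_iff)
      ultimately have "(\<lambda>n. real (p n) * q n) \<longlonglongrightarrow> x powr (- (\<alpha> / 2))"
        by (auto dest: Lim_transform_eventually)
      from power_tendsto_exp_minus[OF this p_lim]
      have "(\<lambda>n. (1 - q n) ^ p n) \<longlonglongrightarrow> frechet_cdf (\<alpha> / 2) x"
        using x by (simp add: frechet_cdf_def)
      moreover have "\<forall>\<^sub>F n in sequentially. (1 - q n) ^ p n = f n x"
        using big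
      proof eventually_elim
        case (elim n)
        have "f n x = prob {\<omega> \<in> space M. (MAX i\<in>{1..p n}. V n i \<omega>) \<le> c (n * p n) * x}"
          using cnp[of n] elim by (simp add: f_def W_def pos_divide_le_eq mult.commute)
        also have "\<dots> = prob {\<omega> \<in> space M. V n 1 \<omega> \<le> c (n * p n) * x} ^ p n"
          using elim by (intro prob_Max_iid_le V_iid) simp
        also have "prob {\<omega> \<in> space M. V n 1 \<omega> \<le> c (n * p n) * x} = 1 - q n"
        proof -
          have [measurable]: "V n 1 \<in> borel_measurable M" by (rule V_meas) simp
          have "{\<omega> \<in> space M. V n 1 \<omega> > c (n * p n) * x} \<in> events" by measurable
          from prob_neg[OF this] show ?thesis
            unfolding q_def not_less .
        qed
        finally show ?case by simp
      qed
      ultimately show ?thesis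
        by (rule Lim_transform_eventually)
    qed
    then have conv: "(\<lambda>n. f n x) \<longlonglongrightarrow> frechet_cdf (\<alpha> / 2) x" for x
    proof (rule frechet_limit_from_positive[rotated 2])
      show "f n x \<le> f n y" if "x \<le> y" for n x y
        unfolding f_def using that by (intro finite_measure_mono) auto
      show "f n x \<ge> 0" for n x
        by (simp add: f_def)
      show "\<alpha> / 2 > 0"
        using alpha by simp
    qed
    have "cdf (distr M borel (W n)) x = f n x" for n x
      unfolding cdf_def f_def by (subst measure_distr) (auto simp: vimage_def Int_def conj_commute)
    then have "tendsto_in_distribution M W K Y"
      unfolding tendsto_in_distribution_def weak_conv_m_def weak_conv_def Y_frechet(2)
      using conv by simp
    then show ?thesis
      by (simp add: W_def[abs_def] V_def)
  qed
  ultimately show ?thesis ..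
qed

end
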